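(* Let $\Bbbk$ be an algebraically closed field of characteristic $0$ and let $\mathfrak g$ be a finite-dimensional Lie algebra over $\Bbbk$. Then $\mathfrak g$ has a very nilpotent basis if and only if $\mathfrak g$ is a nilpotent Lie algebra.
   Context: For $z\in\mathfrak g$, $\operatorname{ad}_z\in\mathfrak{gl}(\mathfrak g)$ denotes the map $x\mapsto [z,x]$. Iterated brackets: for $n\ge 1$, let $\mathcal I_n$ be the smallest set of maps $\mathfrak g^n\to\mathfrak g$ such that (1) each coordinate map $(y_1,\dots,y_n)\mapsto y_i$, $1\le i\le n$, belongs to $\mathcal I_n$; (2) if $f,g\in\mathcal I_n$, then the map $[f,g]:(y_1,\dots,y_n)\mapsto [f(y_1,\dots,y_n),g(y_1,\dots,y_n)]$ belongs to $\mathcal I_n$. For $y_1,\dots,y_n\in\mathfrak g$ put $\mathcal I(y_1,\dots,y_n)=\{f(y_1,\dots,y_n)\mid f\in\mathcal I_n\}$, the set of iterated brackets in $y_1,\dots,y_n$. A tuple $(y_1,\dots,y_n)$ is a very nilpotent basis of $\mathfrak g$ if $(y_1,\dots,y_n)$ is a basis of the vector space $\mathfrak g$ and $\operatorname{ad}_z$ is a nilpotent endomorphism of $\mathfrak g$ for every $z\in\mathcal I(y_1,\dots,y_n)$. For $\mathfrak g=\{0\}$ the empty basis is counted as very nilpotent. *)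

theory Defs
  imports "HOL-Computational_Algebra.Polynomial"
begin

locale lie_algebra = vector_space scale
  for scale :: "'k::field \<Rightarrow> 'g::ab_group_add \<Rightarrow> 'g" +
  fixes bracket :: "'g \<Rightarrow> 'g \<Rightarrow> 'g"
  assumes bracket_add_left: "bracket (x + y) z = bracket x z + bracket y z"
    and bracket_scale_left: "bracket (scale c x) z = scale c (bracket x z)"
    and bracket_add_right: "bracket x (y + z) = bracket x y + bracket x z"
    and bracket_scale_right: "bracket x (scale c z) = scale c (bracket x z)"
    and bracket_self: "bracket x x = 0"
    and jacobi: "bracket x (bracket y z) + bracket y (bracket z x) + bracket z (bracket x y) = 0"

definition nilpotent_map :: "('g::zero \<Rightarrow> 'g) \<Rightarrow> bool" where
  "nilpotent_map f \<longleftrightarrow> (\<exists>m. f ^^ m = (\<lambda>_. 0))"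

context lie_algebra
begin

definition ad :: "'g \<Rightarrow> 'g \<Rightarrow> 'g" where
  "ad z = (\<lambda>x. bracket z x)"

lemma linear_ad: "Vector_Spaces.linear scale scale (ad z)"
  unfolding ad_def by (unfold_locales) (simp_all add: bracket_add_right bracket_scale_right)

primrec lower_central_series :: "nat \<Rightarrow> 'g set" where
  "lower_central_series 0 = UNIV"
| "lower_central_series (Suc i) = span {bracket x y | x y. y \<in> lower_central_series i}"

definition nilpotent :: bool where
  "nilpotent \<longleftrightarrow> (\<exists>i. lower_central_series i = {0})"

(* An n-tuple is a list of length n, with 0-based entries; the values of the maps below
   on lists of any other length are irrelevant, see iterated_brackets. *)
inductive_set bracket_maps :: "nat \<Rightarrow> ('g list \<Rightarrow> 'g) set" for n :: nat where
  coordinate: "i < n \<Longrightarrow> (\<lambda>ys. ys ! i) \<in> bracket_maps n"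
| bracket: "f \<in> bracket_maps n \<Longrightarrow> g \<in> bracket_maps n
    \<Longrightarrow> (\<lambda>ys. bracket (f ys) (g ys)) \<in> bracket_maps n"

definition iterated_brackets :: "'g list \<Rightarrow> 'g set" where
  "iterated_brackets ys = {f ys | f. f \<in> bracket_maps (length ys)}"

definition is_basis :: "'g list \<Rightarrow> bool" where
  "is_basis ys \<longleftrightarrow> distinct ys \<and> independent (set ys) \<and> span (set ys) = UNIV"

(* For the zero Lie algebra the empty list qualifies: it is a basis, and
   iterated_brackets [] is empty. *)
definition very_nilpotent_basis :: "'g list \<Rightarrow> bool" where
  "very_nilpotent_basis ys \<longleftrightarrow>
     is_basis ys \<and> (\<forall>z \<in> iterated_brackets ys. nilpotent_map (ad z))"

end

end

theory Submission
  imports Defs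
begin

text \<open>
  If \<open>\<gg>\<close> is nilpotent, every \<open>ad z\<close> is nilpotent, because \<open>(ad z)\<^sup>m\<close> maps \<open>\<gg>\<close> into the \<open>m\<close>-th
  term of the lower central series; so any basis is very nilpotent.

  Conversely, the iterated brackets of a very nilpotent basis form a spanning set \<open>S\<close> of
  ad-nilpotent elements that is closed under the bracket but need not be a subspace. Nilpotency then
  follows from Jacobson's strengthening of Engel's theorem (\<open>nilpotent_if_spanning_bracket_closed\<close>),
  proved here for the adjoint representation. The idea is to grow a subalgebra \<open>H\<close>, spanned by the
  elements of \<open>S\<close> that it contains, which acts nilpotently on all of \<open>\<gg>\<close>: some fixed number of
  brackets with elements of \<open>H\<close> kills every vector. While \<open>H \<noteq> \<gg>\<close>, some \<open>s \<in> S\<close> lies outside \<open>H\<close>;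
  repeatedly replacing \<open>s\<close> by a bracket \<open>[t, s]\<close> with \<open>t \<in> S \<inter> H\<close> that is still outside \<open>H\<close> has to
  stop, as \<open>H\<close> acts nilpotently, and the last \<open>s\<close> normalizes \<open>H\<close> (\<open>obtain_normalizing_element\<close>).
  Adjoining \<open>s\<close> to \<open>H\<close> preserves the nilpotency of the action
  (\<open>acts_nilpotently_span_insert\<close>) and raises the dimension, so after finitely many steps \<open>H = \<gg>\<close>.
\<close>

section \<open>Lie bracket identities\<close>

context lie_algebra
begin

lemma bracket_zero_left [simp]: "bracket 0 x = 0"
  using bracket_add_left[of 0 0 x] by simp

lemma bracket_zero_right [simp]: "bracket x 0 = 0"
  using bracket_add_right[of x 0 0] by simp

lemma bracket_antisym: "bracket x y = - bracket y x"
proof -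
  have "bracket x y + bracket y x = bracket (x + y) (x + y)"
    by (simp only: bracket_add_left bracket_add_right) (simp add: bracket_self)
  then show ?thesis
    by (simp add: bracket_self eq_neg_iff_add_eq_0)
qed

lemma bracket_minus_right: "bracket x (- y) = - bracket x y"
  using bracket_add_right[of x y "- y"] by (simp add: eq_neg_iff_add_eq_0 add.commute)

lemma bracket_derivation:
  "bracket x (bracket y z) = bracket (bracket x y) z + bracket y (bracket x z)"
proof -
  have "bracket y (bracket z x) = - bracket y (bracket x z)"
    by (metis bracket_antisym bracket_minus_right)
  moreover have "bracket z (bracket x y) = - bracket (bracket x y) z"
    by (rule bracket_antisym)
  ultimately show ?thesis
    using jacobi[of x y z] by (simp add: algebra_simps)
qed

lemma subspace_vimage_bracket_right: "subspace A \<Longrightarrow> subspace {v. bracket w v \<in> A}"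
  by (simp add: subspace_def bracket_add_right bracket_scale_right)

lemma subspace_vimage_bracket_left: "subspace A \<Longrightarrow> subspace {v. bracket v w \<in> A}"
  by (simp add: subspace_def bracket_add_left bracket_scale_left)

section \<open>Nilpotent actions on the Lie algebra\<close>

text \<open>
  The lower central series relative to a set of acting elements. Its vanishing at some index
  expresses that all sufficiently long products of maps \<open>ad h\<close> with \<open>h \<in> H\<close> are zero.
\<close>

primrec action_series :: "'g set \<Rightarrow> nat \<Rightarrow> 'g set" where
  "action_series H 0 = UNIV"
| "action_series H (Suc i) = span {bracket h v | h v. h \<in> H \<and> v \<in> action_series H i}"

definition acts_nilpotently :: "'g set \<Rightarrow> bool" where
  "acts_nilpotently H \<longleftrightarrow> (\<exists>k. action_series H k \<subseteq> {0})"

lemma subspace_action_series: "subspace (action_series H i)"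
  by (cases i) (simp_all add: subspace_UNIV)

lemma bracket_in_action_series:
  "h \<in> H \<Longrightarrow> v \<in> action_series H i \<Longrightarrow> bracket h v \<in> action_series H (Suc i)"
  by (auto intro: span_base)

lemma action_series_Suc_subset: "action_series H (Suc i) \<subseteq> action_series H i"
proof (induction i)
  case (Suc i)
  then have "{bracket h v | h v. h \<in> H \<and> v \<in> action_series H (Suc i)}
      \<subseteq> {bracket h v | h v. h \<in> H \<and> v \<in> action_series H i}"
    by blast
  then show ?case
    unfolding action_series.simps(2)[of H "Suc i"] action_series.simps(2)[of H i]
    by (rule span_mono)
qed simp

lemma action_series_UNIV: "action_series UNIV i = lower_central_series i"
  by (induction i) simp_all

lemma nilpotent_iff_acts_nilpotently: "nilpotent \<longleftrightarrow> acts_nilpotently UNIV"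
proof -
  have "action_series UNIV i \<subseteq> {0} \<longleftrightarrow> lower_central_series i = {0}" for i
    using subspace_0[OF subspace_action_series, of UNIV i] by (auto simp: action_series_UNIV)
  then show ?thesis
    by (simp add: nilpotent_def acts_nilpotently_def)
qed

section \<open>Adjoining a normalizing element\<close>

text \<open>
  A normalizing element preserves each term since \<open>[s, [h, v]] = [[s, h], v] + [h, [s, v]]\<close>.
\<close>

lemma normalizer_preserves_action_series:
  assumes normalizes: "\<And>h. h \<in> H \<Longrightarrow> bracket s h \<in> H"
    and "v \<in> action_series H i"
  shows "bracket s v \<in> action_series H i"
  using assms(2)
proof (induction i arbitrary: v)
  case (Suc i)
  have "bracket s (bracket h u) \<in> action_series H (Suc i)"
    if "h \<in> H" "u \<in> action_series H i" for h u
    unfolding bracket_derivation[of s h u] using that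
    by (intro subspace_add[OF subspace_action_series] bracket_in_action_series normalizes Suc.IH)
  then have "{bracket h u | h u. h \<in> H \<and> u \<in> action_series H i}
      \<subseteq> {v. bracket s v \<in> action_series H (Suc i)}"
    by blast
  then have "action_series H (Suc i) \<subseteq> {v. bracket s v \<in> action_series H (Suc i)}"
    unfolding action_series.simps(2)
    by (intro span_minimal subspace_vimage_bracket_right) simp_all
  then show ?case using Suc.prems by blast
qed simp

text \<open>
  Write \<open>V\<^sub>i\<close> for the action series of \<open>H\<close> and \<open>W\<close> for the span of \<open>H\<close> and \<open>s\<close>. On \<open>V\<^sub>i\<close> modulo
  \<open>V\<^sub>i\<^sub>+\<^sub>1\<close> the elements of \<open>H\<close> act as zero and \<open>s\<close> acts as an endomorphism, so \<open>j\<close> brackets with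
  elements of \<open>W\<close> amount to a multiple of \<open>(ad s)\<^sup>j\<close>.
\<close>

lemma action_series_span_insert:
  assumes "subspace H"
    and normalizes: "\<And>h. h \<in> H \<Longrightarrow> bracket s h \<in> H"
    and start: "action_series (span (insert s H)) m \<subseteq> action_series H i"
  shows "action_series (span (insert s H)) (m + j)
    \<subseteq> span ((ad s ^^ j) ` action_series H i \<union> action_series H (Suc i))"
proof (induction j)
  case 0
  have "action_series H i \<subseteq> span ((ad s ^^ 0) ` action_series H i \<union> action_series H (Suc i))"
    by (auto intro: span_base)
  with start show ?case by auto
next
  case (Suc j)
  let ?V = "action_series H" and ?W = "span (insert s H)"
  let ?G = "\<lambda>j. (ad s ^^ j) ` ?V i \<union> ?V (Suc i)"
  have power_in: "(ad s ^^ j) u \<in> ?V i" if "u \<in> ?V i" for u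
    using that
    by (induction j) (auto simp: ad_def intro: normalizer_preserves_action_series normalizes)
  have bracket_generator: "bracket w v \<in> span (?G (Suc j))" if w: "w \<in> ?W" and v: "v \<in> ?G j" for w v
  proof -
    obtain c where c: "w - scale c s \<in> H"
      using w \<open>subspace H\<close> by (auto simp: span_breakdown_eq span_eq_iff[THEN iffD2])
    have "v \<in> ?V i"
      using v power_in action_series_Suc_subset by blast
    then have "bracket (w - scale c s) v \<in> span (?G (Suc j))"
      using bracket_in_action_series[OF c] by (intro span_base) blast
    moreover have "bracket s v \<in> ?G (Suc j)"
    proof (cases "v \<in> ?V (Suc i)")
      case True
      then show ?thesis
        using normalizer_preserves_action_series[OF normalizes] by blast
    next
      case False
      then obtain u where "u \<in> ?V i" "v = (ad s ^^ j) u"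
        using v by blast
      then show ?thesis by (auto simp: ad_def)
    qed
    then have "scale c (bracket s v) \<in> span (?G (Suc j))"
      by (intro span_scale span_base)
    moreover have "bracket w v = bracket (w - scale c s) v + scale c (bracket s v)"
      by (metis bracket_add_left bracket_scale_left diff_add_cancel)
    ultimately show ?thesis
      by (simp add: span_add)
  qed
  have "bracket w v \<in> span (?G (Suc j))" if "w \<in> ?W" "v \<in> action_series ?W (m + j)" for w v
  proof -
    have "span (?G j) \<subseteq> {v. bracket w v \<in> span (?G (Suc j))}"
      using bracket_generator[OF that(1)]
      by (intro span_minimal subspace_vimage_bracket_right) auto
    then show ?thesis using Suc.IH that(2) by blast
  qed
  then show ?case
    unfolding add_Suc_right action_series.simps(2)[of ?W]
    by (intro span_minimal) auto
qed

text \<open>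
  If \<open>(ad s)\<^sup>N = 0\<close>, then \<open>N\<close> brackets with elements of the enlarged space descend one step in the
  action series of \<open>H\<close>.
\<close>

lemma acts_nilpotently_span_insert:
  assumes "subspace H"
    and normalizes: "\<And>h. h \<in> H \<Longrightarrow> bracket s h \<in> H"
    and "nilpotent_map (ad s)"
    and "acts_nilpotently H"
  shows "acts_nilpotently (span (insert s H))"
proof -
  obtain N where N: "ad s ^^ N = (\<lambda>_. 0)"
    using assms(3) unfolding nilpotent_map_def by blast
  have "\<exists>m. action_series (span (insert s H)) m \<subseteq> action_series H i" for i
  proof (induction i)
    case (Suc i)
    then obtain m where "action_series (span (insert s H)) m \<subseteq> action_series H i"
      by blast
    then have "action_series (span (insert s H)) (m + N)
        \<subseteq> span ((ad s ^^ N) ` action_series H i \<union> action_series H (Suc i))"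
      using action_series_span_insert[OF assms(1) normalizes] by blast
    also have "\<dots> \<subseteq> action_series H (Suc i)"
    proof (rule span_minimal)
      show "(ad s ^^ N) ` action_series H i \<union> action_series H (Suc i) \<subseteq> action_series H (Suc i)"
        using subspace_0[OF subspace_action_series, of H "Suc i"] unfolding N by blast
    qed (rule subspace_action_series)
    finally show ?case by blast
  qed simp
  then show ?thesis
    using assms(4) unfolding acts_nilpotently_def by (meson subset_trans)
qed

text \<open>
  If no element of \<open>S - H\<close> normalized \<open>H\<close>, each one could be bracketed with an element of \<open>S \<inter> H\<close>
  without entering \<open>H\<close>, giving elements of \<open>S - H\<close> arbitrarily deep in the action series of \<open>H\<close>.
\<close>

lemma obtain_normalizing_element:
  assumes closed: "\<And>x y. x \<in> S \<Longrightarrow> y \<in> S \<Longrightarrow> bracket x y \<in> S"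
    and spanned: "span (S \<inter> H) = H"
    and "acts_nilpotently H"
    and "\<not> S \<subseteq> H"
  obtains s where "s \<in> S" "s \<notin> H" "\<And>h. h \<in> H \<Longrightarrow> bracket s h \<in> H"
proof (rule ccontr)
  assume none: "\<not> thesis"
  have subspace: "subspace H"
    using subspace_span[of "S \<inter> H"] spanned by simp
  have escape: "\<exists>t \<in> S \<inter> H. bracket t s \<notin> H" if "s \<in> S" "s \<notin> H" for s
  proof (rule ccontr)
    assume "\<not> ?thesis"
    then have "span (S \<inter> H) \<subseteq> {h. bracket h s \<in> H}"
      by (intro span_minimal subspace_vimage_bracket_left subspace) blast
    then have "bracket s h \<in> H" if "h \<in> H" for h
      using that spanned subspace_neg[OF subspace] bracket_antisym[of s h] by auto
    then show False using none that \<open>\<And>s. \<lbrakk>s \<in> S; s \<notin> H; \<And>h. h \<in> H \<Longrightarrow> bracket s h \<in> H\<rbrakk> \<Longrightarrow> thesis\<close>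
      by blast
  qed
  have "\<exists>s \<in> S. s \<notin> H \<and> s \<in> action_series H n" for n
  proof (induction n)
    case 0
    then show ?case using assms(4) by auto
  next
    case (Suc n)
    then obtain s where s: "s \<in> S" "s \<notin> H" "s \<in> action_series H n" by blast
    with escape obtain t where "t \<in> S \<inter> H" "bracket t s \<notin> H" by blast
    with s closed bracket_in_action_series show ?case by blast
  qed
  moreover obtain k where "action_series H k \<subseteq> {0}"
    using assms(3) unfolding acts_nilpotently_def by blast
  ultimately show False
    using subspace_0[OF subspace] by blast
qed

lemma subalgebra_span_insert:
  assumes "subspace H"
    and subalgebra: "\<And>x y. x \<in> H \<Longrightarrow> y \<in> H \<Longrightarrow> bracket x y \<in> H"
    and normalizes: "\<And>h. h \<in> H \<Longrightarrow> bracket s h \<in> H"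
    and "x \<in> span (insert s H)" "y \<in> span (insert s H)"
  shows "bracket x y \<in> span (insert s H)"
proof -
  let ?W = "span (insert s H)"
  have H: "z \<in> ?W" if "z \<in> H" for z
    using that by (auto intro: span_base)
  have normalizes': "bracket h s \<in> H" if "h \<in> H" for h
    using subspace_neg[OF assms(1) normalizes[OF that]] bracket_antisym[of h s] by simp
  have "bracket a b \<in> ?W" if "a \<in> insert s H" "b \<in> insert s H" for a b
    using that H subalgebra normalizes normalizes' by (auto simp: bracket_self span_zero)
  then have "bracket a y \<in> ?W" if "a \<in> insert s H" for a
    using that assms(5) span_minimal[OF _ subspace_vimage_bracket_right[OF subspace_span]]
    by (metis (mono_tags, lifting) mem_Collect_eq subset_iff)
  then have "?W \<subseteq> {x. bracket x y \<in> ?W}"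
    by (intro span_minimal subspace_vimage_bracket_left) auto
  then show ?thesis using assms(4) by blast
qed

section \<open>Iterated brackets and the lower central series\<close>

lemma iterated_brackets_closed:
  "x \<in> iterated_brackets ys \<Longrightarrow> y \<in> iterated_brackets ys \<Longrightarrow> bracket x y \<in> iterated_brackets ys"
  unfolding iterated_brackets_def using bracket_maps.bracket by fastforce

lemma set_subset_iterated_brackets: "set ys \<subseteq> iterated_brackets ys"
  unfolding iterated_brackets_def by (fastforce simp: in_set_conv_nth intro: coordinate)

lemma ad_power_in_lower_central_series: "(ad z ^^ m) x \<in> lower_central_series m"
  by (induction m) (auto simp: ad_def intro: span_base)

lemma nilpotent_map_ad_if_nilpotent: "nilpotent \<Longrightarrow> nilpotent_map (ad z)"
  unfolding nilpotent_def nilpotent_map_def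
  using ad_power_in_lower_central_series by (metis singletonD)

end

section \<open>Jacobson's theorem and very nilpotent bases\<close>

locale finite_dimensional_lie_algebra =
  lie_algebra scale bracket + finite_dimensional_vector_space scale Basis
  for scale :: "'k::field \<Rightarrow> 'g::ab_group_add \<Rightarrow> 'g"
    and bracket :: "'g \<Rightarrow> 'g \<Rightarrow> 'g"
    and Basis :: "'g set"
begin

text \<open>
  Jacobson's form of Engel's theorem, for the adjoint representation. The invariant carried by \<open>H\<close>
  includes that \<open>H\<close> is spanned by elements of \<open>S\<close>: the search for a normalizing element uses only
  brackets with such elements, so as to stay in \<open>S\<close>, where \<open>ad\<close> is known to be nilpotent.
\<close>

theorem nilpotent_if_spanning_bracket_closed:
  assumes closed: "\<And>x y. x \<in> S \<Longrightarrow> y \<in> S \<Longrightarrow> bracket x y \<in> S"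
    and spanning: "span S = UNIV"
    and ad_nilpotent: "\<And>s. s \<in> S \<Longrightarrow> nilpotent_map (ad s)"
  shows nilpotent
proof -
  have "acts_nilpotently UNIV"
    if "span (S \<inter> H) = H" "\<And>x y. x \<in> H \<Longrightarrow> y \<in> H \<Longrightarrow> bracket x y \<in> H" "acts_nilpotently H" for H
    using that
  proof (induction "dim UNIV - dim H" arbitrary: H rule: less_induct)
    case less
    have subspace: "subspace H"
      using subspace_span[of "S \<inter> H"] less.prems(1) by simp
    show ?case
    proof (cases "S \<subseteq> H")
      case True
      then have "H = UNIV"
        using span_minimal[OF _ subspace] spanning by blast
      then show ?thesis using less.prems(3) by simp
    next
      case False
      obtain s where s: "s \<in> S" "s \<notin> H" "\<And>h. h \<in> H \<Longrightarrow> bracket s h \<in> H"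
        using obtain_normalizing_element[OF closed less.prems(1,3) False] by blast
      let ?W = "span (insert s H)"
      have "s \<notin> span H"
        using s(2) subspace by (simp add: span_eq_iff[THEN iffD2])
      then have "dim ?W = Suc (dim H)"
        by (simp add: dim_insert)
      moreover have "dim ?W \<le> dim UNIV"
        by (rule dim_subset) simp
      ultimately have decrease: "dim UNIV - dim ?W < dim UNIV - dim H"
        by linarith
      have "insert s (S \<inter> H) \<subseteq> S \<inter> ?W"
        using s(1) by (auto intro: span_base)
      then have "insert s H \<subseteq> span (S \<inter> ?W)"
        using span_mono[of "S \<inter> H" "S \<inter> ?W"] less.prems(1) by (auto intro: span_base)
      then have "?W \<subseteq> span (S \<inter> ?W)"
        by (rule span_minimal) simp
      moreover have "span (S \<inter> ?W) \<subseteq> ?W"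
        by (rule span_minimal) simp_all
      ultimately have "span (S \<inter> ?W) = ?W" by blast
      then show ?thesis
        using decrease subalgebra_span_insert[OF subspace less.prems(2) s(3)]
          acts_nilpotently_span_insert[OF subspace s(3) ad_nilpotent[OF s(1)] less.prems(3)]
        by (intro less.hyps[of ?W]) blast+
    qed
  qed
  moreover have "span (S \<inter> {0}) = {0}"
    by (cases "0 \<in> S") simp_all
  moreover have "action_series {0} (Suc 0) \<subseteq> {0}"
    by simp
  then have "acts_nilpotently {0}"
    unfolding acts_nilpotently_def by blast
  ultimately have "acts_nilpotently UNIV"
    by (metis bracket_zero_left singletonD singletonI)
  then show ?thesis
    by (simp add: nilpotent_iff_acts_nilpotently)
qed

theorem ex_very_nilpotent_basis_iff_nilpotent: "(\<exists>ys. very_nilpotent_basis ys) \<longleftrightarrow> nilpotent"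
proof
  assume "\<exists>ys. very_nilpotent_basis ys"
  then obtain ys where ys: "span (set ys) = UNIV"
    "\<And>z. z \<in> iterated_brackets ys \<Longrightarrow> nilpotent_map (ad z)"
    unfolding very_nilpotent_basis_def is_basis_def by blast
  have "span (iterated_brackets ys) = UNIV"
    using span_mono[OF set_subset_iterated_brackets[of ys]] ys(1) by blast
  then show nilpotent
    using nilpotent_if_spanning_bracket_closed[OF iterated_brackets_closed _ ys(2)] by blast
next
  assume nilpotent
  moreover obtain ys where "set ys = Basis" "distinct ys"
    using finite_distinct_list[OF finite_Basis] by blast
  ultimately have "very_nilpotent_basis ys"
    unfolding very_nilpotent_basis_def is_basis_def
    using independent_Basis span_Basis nilpotent_map_ad_if_nilpotent by simp
  then show "\<exists>ys. very_nilpotent_basis ys" ..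
qed

end

theorem proposition1:
  fixes scale :: "'k::{alg_closed_field, field_char_0} \<Rightarrow> 'g::ab_group_add \<Rightarrow> 'g"
    and bracket :: "'g \<Rightarrow> 'g \<Rightarrow> 'g"
  assumes "lie_algebra scale bracket"
    and "\<exists>B. finite_dimensional_vector_space scale B"
  shows "(\<exists>ys. lie_algebra.very_nilpotent_basis scale bracket ys)
    \<longleftrightarrow> lie_algebra.nilpotent scale bracket"
proof -
  obtain B where "finite_dimensional_vector_space scale B"
    using assms(2) by blast
  with assms(1) have "finite_dimensional_lie_algebra scale bracket B"
    by (rule finite_dimensional_lie_algebra.intro)
  then show ?thesis
    by (rule finite_dimensional_lie_algebra.ex_very_nilpotent_basis_iff_nilpotent)
qed

end
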